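(* For a proper, lower semicontinuous, and convex function $g$, minimization of the augmented Lagrangian $$\mathcal{L}_\mu(x,z;y)=f(x)+g(z)+\langle y,\mathcal{T}(x)-z\rangle+\tfrac{1}{2\mu}\|\mathcal{T}(x)-z\|^2$$ over $(x,z)$ is equivalent to minimization of the proximal augmented Lagrangian $$\mathcal{L}_\mu(x;y):=f(x)+M_{\mu g}(\mathcal{T}(x)+\mu y)-\tfrac{\mu}{2}\|y\|^2$$ over $x$. Moreover, if $f$ is continuously differentiable, then $\mathcal{L}_\mu(x;y)$ is continuously differentiable over $x$ and $y$; and if $f$ has a Lipschitz continuous gradient, then $\nabla\mathcal{L}_\mu(x;y)$ is Lipschitz continuous.
   Context: The underlying problem is to minimize $f(x)+g(\mathcal{T}(x))$ over $x$ in a finite-dimensional Hilbert space (e.g. $\mathbb{R}^n$ or $\mathbb{R}^{m\times n}$) with inner product $\langle\cdot,\cdot\rangle$ and associated norm $\|\cdot\|$, where $\mathcal{T}$ is a bounded linear operator into a finite-dimensional Hilbert space (whose inner product and norm are denoted in the same way). Standing assumptions: $f$ is continuously differentiable but possibly nonconvex; $g$ is convex, possibly nondifferentiable, proper and lower semicontinuous; the problem is feasible and its minimum is finite. The problem is rewritten with an auxiliary variable $z$ as: minimize $f(x)+g(z)$ over $(x,z)$ subject to $\mathcal{T}(x)-z=0$. The function $\mathcal{L}_\mu(x,z;y)$ is the augmented Lagrangian of this constrained problem, where $y$ is the Lagrange multiplier (in the same space as $z$) and $\mu>0$ is a parameter. The proximal operator of $g$ is $\mathbf{prox}_{\mu g}(v)=\operatorname*{argmin}_{u}\big(g(u)+\tfrac{1}{2\mu}\|u-v\|^2\big)$,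 and the Moreau envelope of $g$ is $M_{\mu g}(v)=g(\mathbf{prox}_{\mu g}(v))+\tfrac{1}{2\mu}\|\mathbf{prox}_{\mu g}(v)-v\|^2$. The gradient $\nabla\mathcal{L}_\mu(x;y)$ is taken with respect to $(x,y)$. *)

theory Defs
  imports "HOL-Analysis.Analysis"
begin

text \<open>Convex-analysis vocabulary for extended-real-valued functions on the whole space.\<close>

definition proper_fun :: "('b \<Rightarrow> ereal) \<Rightarrow> bool" where
  "proper_fun g \<longleftrightarrow> (\<forall>v. g v \<noteq> -\<infinity>) \<and> (\<exists>v. g v \<noteq> \<infinity>)"

definition lower_semicontinuous :: "('b::topological_space \<Rightarrow> ereal) \<Rightarrow> bool" where
  "lower_semicontinuous g \<longleftrightarrow> (\<forall>v. g v \<le> Liminf (at v) g)"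

text \<open>This is the usual notion only for functions that never take the value \<open>-\<infinity>\<close>, since
  \<open>\<infinity> + -\<infinity> = \<infinity>\<close> in type \<^typ>\<open>ereal\<close>; it is used below together with \<open>proper_fun\<close>.
  The endpoints are harmless because \<open>0 * \<infinity> = 0\<close>.\<close>

definition convex_fun :: "('b::real_vector \<Rightarrow> ereal) \<Rightarrow> bool" where
  "convex_fun g \<longleftrightarrow> (\<forall>u v. \<forall>t::real. 0 \<le> t \<and> t \<le> 1 \<longrightarrow>
     g ((1 - t) *\<^sub>R u + t *\<^sub>R v) \<le> ereal (1 - t) * g u + ereal t * g v)"

definition continuously_differentiable :: "('a::real_inner \<Rightarrow> real) \<Rightarrow> bool" where
  "continuously_differentiable f \<longleftrightarrow>
     (\<exists>G. (\<forall>x. GDERIV f x :> G x) \<and> continuous_on UNIV G)"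

definition lipschitz_gradient :: "('a::real_inner \<Rightarrow> real) \<Rightarrow> bool" where
  "lipschitz_gradient f \<longleftrightarrow>
     (\<exists>G L. (\<forall>x. GDERIV f x :> G x) \<and> L-lipschitz_on UNIV G)"

text \<open>As \<^const>\<open>arg_min\<close> is a choice operator, \<open>prox\<close> is meaningful
  only where the minimizer exists and is unique.\<close>

definition prox :: "real \<Rightarrow> ('b::real_inner \<Rightarrow> ereal) \<Rightarrow> 'b \<Rightarrow> 'b" where
  "prox \<mu> g v = arg_min (\<lambda>u. g u + ereal (1 / (2 * \<mu>) * (norm (u - v))\<^sup>2)) (\<lambda>_. True)"

definition moreau_envelope :: "real \<Rightarrow> ('b::real_inner \<Rightarrow> ereal) \<Rightarrow> 'b \<Rightarrow> ereal" where
  "moreau_envelope \<mu> g v =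
     g (prox \<mu> g v) + ereal (1 / (2 * \<mu>) * (norm (prox \<mu> g v - v))\<^sup>2)"

definition aug_lagrangian ::
  "('a \<Rightarrow> real) \<Rightarrow> ('b::real_inner \<Rightarrow> ereal) \<Rightarrow> ('a \<Rightarrow> 'b) \<Rightarrow> real \<Rightarrow> 'a \<Rightarrow> 'b \<Rightarrow> 'b \<Rightarrow> ereal" where
  "aug_lagrangian f g T \<mu> x z y =
     ereal (f x) + g z + ereal (y \<bullet> (T x - z)) + ereal (1 / (2 * \<mu>) * (norm (T x - z))\<^sup>2)"

definition prox_aug_lagrangian ::
  "('a \<Rightarrow> real) \<Rightarrow> ('b::real_inner \<Rightarrow> ereal) \<Rightarrow> ('a \<Rightarrow> 'b) \<Rightarrow> real \<Rightarrow> 'a \<Rightarrow> 'b \<Rightarrow> ereal" where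
  "prox_aug_lagrangian f g T \<mu> x y =
     ereal (f x) + moreau_envelope \<mu> g (T x + \<mu> *\<^sub>R y) - ereal (\<mu> / 2 * (norm y)\<^sup>2)"

text \<open>For a fixed multiplier \<open>y\<close>, minimizing \<open>aug_lagrangian\<close> over \<open>(x, z)\<close> is equivalent to
  minimizing \<open>prox_aug_lagrangian\<close> over \<open>x\<close>: the proximal point is the unique minimizer in \<open>z\<close>
  and substituting it gives \<open>prox_aug_lagrangian\<close>; the optimal values agree; and the minimizers
  correspond under \<open>x \<mapsto> (x, prox \<mu> g (T x + \<mu> y))\<close>. The problems may have no minimizer and
  optimal value \<open>-\<infinity>\<close>.\<close>

definition equivalent_minimization ::
  "('a \<Rightarrow> real) \<Rightarrow> ('b::real_inner \<Rightarrow> ereal) \<Rightarrow> ('a \<Rightarrow> 'b) \<Rightarrow> real \<Rightarrow> 'b \<Rightarrow> bool" where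
  "equivalent_minimization f g T \<mu> y \<longleftrightarrow>
     (\<forall>x z. is_arg_min (\<lambda>z'. aug_lagrangian f g T \<mu> x z' y) (\<lambda>_. True) z
              \<longleftrightarrow> z = prox \<mu> g (T x + \<mu> *\<^sub>R y)) \<and>
     (\<forall>x. aug_lagrangian f g T \<mu> x (prox \<mu> g (T x + \<mu> *\<^sub>R y)) y = prox_aug_lagrangian f g T \<mu> x y) \<and>
     (INF (x, z) \<in> UNIV. aug_lagrangian f g T \<mu> x z y) = (INF x. prox_aug_lagrangian f g T \<mu> x y) \<and>
     (\<forall>x z. is_arg_min (\<lambda>(x', z'). aug_lagrangian f g T \<mu> x' z' y) (\<lambda>_. True) (x, z)
              \<longleftrightarrow> is_arg_min (\<lambda>x'. prox_aug_lagrangian f g T \<mu> x' y) (\<lambda>_. True) x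
                  \<and> z = prox \<mu> g (T x + \<mu> *\<^sub>R y))"

end

theory Submission
  imports Defs
begin

text \<open>Completing the square turns the augmented Lagrangian, as a function of \<open>z\<close>, into the
  proximal objective at \<open>v = T x + \<mu> y\<close> plus a constant. The proximal point \<open>p\<close> of \<open>v\<close> satisfies
  the variational inequality \<open>g u \<ge> g p + (v - p) \<bullet> (u - p) / \<mu>\<close>, which gives uniqueness of the
  minimizer and, by adding two instances, firm nonexpansiveness of the proximal operator. Comparing
  the objective at \<open>w\<close> with its value at the proximal point of \<open>v\<close>, and vice versa, determines
  \<open>M w - M v\<close> up to a quadratic error; hence the Moreau envelope \<open>M\<close> has gradient
  \<open>(v - p) / \<mu>\<close>, which is Lipschitz.\<close>

section \<open>Lower semicontinuous functions: superlevel sets, sums and minima on compact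
  sets\<close>

lemma open_superlevel_lower_semicontinuous:
  assumes "lower_semicontinuous h"
  shows "open {x. c < h x}"
proof (subst open_subopen, intro ballI)
  fix x assume "x \<in> {x. c < h x}"
  then have c: "c < h x" by simp
  also have "h x \<le> Liminf (at x) h"
    using assms by (auto simp: lower_semicontinuous_def)
  finally have "\<forall>\<^sub>F u in at x. c < h u"
    by (rule less_LiminfD)
  \<comment> \<open>The \<open>Liminf\<close> along \<open>at x\<close> ignores \<open>x\<close>
    itself; \<open>c < h x\<close> supplies the missing point, so the bound holds on a full
    neighbourhood.\<close>
  with c have "\<forall>\<^sub>F u in nhds x. c < h u"
    by (auto simp: eventually_at_filter elim: eventually_mono)
  then show "\<exists>S. open S \<and> x \<in> S \<and> S \<subseteq> {x. c < h x}"
    by (auto simp: eventually_nhds)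
qed

lemma lower_semicontinuous_add_continuous:
  fixes \<phi> :: "'b::topological_space \<Rightarrow> real"
  assumes g: "lower_semicontinuous g" and \<phi>: "continuous_on UNIV \<phi>"
  shows "lower_semicontinuous (\<lambda>u. g u + ereal (\<phi> u))"
  unfolding lower_semicontinuous_def le_Liminf_iff
proof (intro allI impI)
  fix x c assume c: "c < g x + ereal (\<phi> x)"
  then have "c - ereal (\<phi> x) < g x"
    by (cases c; cases "g x") auto
  \<comment> \<open>A real \<open>a\<close> strictly between the two sides decouples the summands:
    near \<open>x\<close>, \<open>g\<close> stays above \<open>a\<close> by semicontinuity, and
    \<open>a + \<phi> u\<close> stays above \<open>c\<close> by continuity.\<close>
  then obtain a where a: "c - ereal (\<phi> x) < ereal a" "ereal a < g x"
    using ereal_dense2 by blast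
  have "\<forall>\<^sub>F u in nhds x. ereal a < g u"
    using open_superlevel_lower_semicontinuous[OF g, of "ereal a"] a
    by (auto simp: eventually_nhds)
  then have ev1: "\<forall>\<^sub>F u in at x. ereal a < g u"
    by (auto simp: eventually_at_filter elim: eventually_mono)
  have "(\<phi> \<longlongrightarrow> \<phi> x) (at x)"
    using \<phi> by (simp add: continuous_on)
  then have "((\<lambda>u. ereal (a + \<phi> u)) \<longlongrightarrow> ereal (a + \<phi> x)) (at x)"
    by (intro tendsto_ereal tendsto_add tendsto_const)
  moreover have "c < ereal (a + \<phi> x)"
    using a by (cases c) auto
  ultimately have "\<forall>\<^sub>F u in at x. c < ereal (a + \<phi> u)"
    by (rule order_tendstoD)
  with ev1 show "\<forall>\<^sub>F u in at x. c < g u + ereal (\<phi> u)"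
  proof eventually_elim
    case (elim u)
    have "ereal (a + \<phi> u) \<le> g u + ereal (\<phi> u)"
      using elim(1) by (cases "g u") auto
    with elim(2) show ?case by (rule less_le_trans)
  qed
qed

text \<open>If no point of \<open>K\<close> were minimal, the open sets
  \<open>{x. h y < h x}\<close> with \<open>y\<close> in \<open>K\<close> would cover
  \<open>K\<close>. Let \<open>F\<close> index a finite subcover: a minimizer of \<open>h\<close> on
  \<open>F\<close> lies in one of these sets, so another element of \<open>F\<close> has a smaller
  value, a contradiction.\<close>

lemma lower_semicontinuous_attains_inf:
  assumes h: "lower_semicontinuous h" and K: "compact K" "K \<noteq> {}"
  shows "\<exists>x\<in>K. \<forall>y\<in>K. h x \<le> h y"
proof (rule ccontr)
  assume "\<not> ?thesis"
  then have "K \<subseteq> (\<Union>y\<in>K. {x. h y < h x})"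
    by (auto simp: not_le)
  then obtain F where F: "F \<subseteq> K" "finite F" "K \<subseteq> (\<Union>y\<in>F. {x. h y < h x})"
    using compactE_image[OF K(1), of K "\<lambda>y. {x. h y < h x}"]
      open_superlevel_lower_semicontinuous[OF h] by metis
  from F(3) K(2) have "F \<noteq> {}" by auto
  with F(2) obtain y where y: "y \<in> F" "\<And>z. z \<in> F \<Longrightarrow> h y \<le> h z"
    using ex_is_arg_min_if_finite[of F h] by (auto simp: is_arg_min_linorder)
  with F(1,3) obtain z where "z \<in> F" "h z < h y" by blast
  with y(2)[of z] show False by simp
qed

section \<open>Closed proper convex functions and their decay at infinity\<close>

locale closed_proper_convex =
  fixes g :: "'b::euclidean_space \<Rightarrow> ereal"
  assumes proper: "proper_fun g" and lsc: "lower_semicontinuous g" and convex: "convex_fun g"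
begin

lemma not_MInfty: "g u \<noteq> -\<infinity>"
  using proper by (simp add: proper_fun_def)

lemma finite_point:
  obtains u a where "g u = ereal a"
  using proper by (metis proper_fun_def ereal_cases)

lemma convex_real:
  assumes "g u = ereal a" "g w = ereal b" "0 \<le> t" "t \<le> 1"
  shows "g ((1 - t) *\<^sub>R u + t *\<^sub>R w) \<le> ereal ((1 - t) * a + t * b)"
  using convex assms unfolding convex_fun_def by (metis times_ereal.simps(1) plus_ereal.simps(1))

text \<open>The minimum over a unit ball propagates outwards by convexity, so no separation
  theorem is needed.\<close>

lemma linear_lower_bound: "\<exists>B C. C \<ge> 0 \<and> (\<forall>u. ereal (B - C * norm u) \<le> g u)"
proof -
  obtain u0 a where u0: "g u0 = ereal a" by (rule finite_point)
  obtain m where m: "m \<in> cball u0 1" "\<And>u. u \<in> cball u0 1 \<Longrightarrow> g m \<le> g u"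
    using lower_semicontinuous_attains_inf[OF lsc, of "cball u0 1"] by auto
  from m(2)[of u0] u0 not_MInfty[of m] obtain b where b: "g m = ereal b" "b \<le> a"
    by (cases "g m") auto
  have bound: "ereal (b - (a - b) * norm (u - u0)) \<le> g u" for u
  proof (cases "g u")
    case (real c)
    have "b - (a - b) * norm (u - u0) \<le> c"
    proof (cases "norm (u - u0) \<le> 1")
      case True
      then have "g m \<le> g u"
        by (intro m(2)) (simp add: dist_norm norm_minus_commute)
      then have "b \<le> c" using b real by simp
      moreover have "(a - b) * norm (u - u0) \<ge> 0" using b by simp
      ultimately show ?thesis by linarith
    next
      case False
      define r where "r = norm (u - u0)"
      have r: "r > 1" using False by (simp add: r_def)
      \<comment> \<open>\<open>w\<close> is the point where the segment from \<open>u0\<close> to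
        \<open>u\<close> crosses the unit sphere around \<open>u0\<close>. There \<open>g\<close> is
        at least \<open>b\<close>, and convexity along the segment turns this into a lower bound for
        \<open>c\<close>.\<close>
      define w where "w = (1 - 1 / r) *\<^sub>R u0 + (1 / r) *\<^sub>R u"
      have "w - u0 = (1 / r) *\<^sub>R (u - u0)"
        by (simp add: w_def algebra_simps)
      then have "norm (w - u0) = 1" using r by (auto simp: r_def)
      then have "g m \<le> g w"
        by (intro m(2)) (simp add: dist_norm norm_minus_commute)
      also have "\<dots> \<le> ereal ((1 - 1 / r) * a + (1 / r) * c)"
        unfolding w_def using r by (intro convex_real[OF u0 real]) auto
      finally have "b \<le> (1 - 1 / r) * a + (1 / r) * c" using b by simp
      then have "b * r \<le> ((1 - 1 / r) * a + (1 / r) * c) * r"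
        using r by (intro mult_right_mono) auto
      also have "\<dots> = (r - 1) * a + c" using r by (simp add: field_simps)
      finally have "a - (a - b) * r \<le> c" by (simp add: algebra_simps)
      then show ?thesis using b unfolding r_def by linarith
    qed
    then show ?thesis using real by simp
  qed (use not_MInfty in auto)
  show ?thesis
  proof (intro exI conjI allI)
    show "a - b \<ge> 0" using b by simp
    fix u
    have "(a - b) * norm (u - u0) \<le> (a - b) * (norm u + norm u0)"
      using b by (intro mult_left_mono norm_triangle_ineq4) auto
    then have "b - (a - b) * norm u0 - (a - b) * norm u \<le> b - (a - b) * norm (u - u0)"
      by (simp add: algebra_simps)
    then have "ereal (b - (a - b) * norm u0 - (a - b) * norm u) \<le> ereal (b - (a - b) * norm (u - u0))"
      by simp
    also have "\<dots> \<le> g u" by (rule bound)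
    finally show "ereal (b - (a - b) * norm u0 - (a - b) * norm u) \<le> g u" .
  qed
qed

end

section \<open>The proximal operator: existence, uniqueness and nonexpansiveness\<close>

locale moreau = closed_proper_convex +
  fixes \<mu> :: real
  assumes \<mu>: "\<mu> > 0"
begin

definition obj :: "'a \<Rightarrow> 'a \<Rightarrow> ereal" where
  "obj v u = g u + ereal (1 / (2 * \<mu>) * (norm (u - v))\<^sup>2)"

text \<open>Because \<open>prox\<close> is a choice, it suffices that some minimizer exists. The
  quadratic term outgrows the at most linear decay of \<open>g\<close>, so the search can be
  confined to a closed ball around \<open>v\<close>, where compactness and semicontinuity give a
  minimizer.\<close>

lemma prox_minimizer: "obj v (prox \<mu> g v) \<le> obj v u"
proof -
  obtain u0 a where u0: "g u0 = ereal a" by (rule finite_point)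
  obtain B C where C: "C \<ge> 0" and B: "\<And>u. ereal (B - C * norm u) \<le> g u"
    using linear_lower_bound by auto
  define c0 where "c0 = a + 1 / (2 * \<mu>) * (norm (u0 - v))\<^sup>2"
  have c0: "obj v u0 = ereal c0" by (simp add: obj_def u0 c0_def)
  \<comment> \<open>\<open>k\<close> absorbs the constants in the comparison with \<open>c0\<close>.
    For \<open>r \<ge> R\<close>, both \<open>r \<ge> 1\<close> and
    \<open>r / (2 * \<mu>) - C \<ge> k + 1\<close> hold, so their product, the quadratic minus the
    linear term, is at least \<open>k + 1\<close>.\<close>
  define k where "k = \<bar>c0 - B + C * norm v\<bar>"
  define R where "R = max 1 (2 * \<mu> * (C + k + 1))"
  have far: "obj v u0 < obj v u" if "norm (u - v) \<ge> R" for u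
  proof -
    define r where "r = norm (u - v)"
    have r: "r \<ge> 1" "r \<ge> 2 * \<mu> * (C + k + 1)" using that by (auto simp: R_def r_def)
    then have "r / (2 * \<mu>) \<ge> C + k + 1" using \<mu> by (simp add: field_simps)
    then have "1 * (k + 1) \<le> r * (r / (2 * \<mu>) - C)"
      using r by (intro mult_mono) (auto simp: k_def)
    also have "\<dots> = 1 / (2 * \<mu>) * r\<^sup>2 - C * r"
      by (simp add: algebra_simps power2_eq_square)
    finally have 1: "k + 1 \<le> 1 / (2 * \<mu>) * r\<^sup>2 - C * r" by simp
    have "norm u \<le> r + norm v"
      using norm_triangle_ineq[of "u - v" v] by (simp add: r_def)
    then have "C * norm u \<le> C * r + C * norm v"
      using C by (metis distrib_left mult_left_mono)
    with 1 have "c0 < (B - C * norm u) + 1 / (2 * \<mu>) * r\<^sup>2"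
      unfolding k_def by linarith
    moreover have "ereal ((B - C * norm u) + 1 / (2 * \<mu>) * r\<^sup>2) \<le> obj v u"
      using B[of u] by (cases "g u") (auto simp: obj_def r_def)
    ultimately show ?thesis unfolding c0 by (metis less_ereal.simps(1) less_le_trans)
  qed
  have lsc': "lower_semicontinuous (obj v)"
    unfolding obj_def[abs_def]
    by (intro lower_semicontinuous_add_continuous lsc continuous_intros)
  have "cball v R \<noteq> {}" by (simp add: R_def)
  then obtain p where p: "\<And>u. u \<in> cball v R \<Longrightarrow> obj v p \<le> obj v u"
    using lower_semicontinuous_attains_inf[OF lsc', of "cball v R"] by (meson compact_cball)
  \<comment> \<open>Otherwise \<open>far\<close> would give
    \<open>obj v u0 < obj v u0\<close>.\<close>
  have "u0 \<in> cball v R"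
    using far[of u0] by (cases "norm (u0 - v) \<ge> R") (auto simp: dist_norm norm_minus_commute)
  with p have pu0: "obj v p \<le> obj v u0" by blast
  have "obj v p \<le> obj v u" for u
  proof (cases "u \<in> cball v R")
    case False
    then show ?thesis using far[of u] pu0
      by (auto simp: dist_norm norm_minus_commute)
  qed (rule p)
  then have "is_arg_min (obj v) (\<lambda>_. True) p"
    by (auto simp: is_arg_min_def not_less)
  then have "is_arg_min (obj v) (\<lambda>_. True) (prox \<mu> g v)"
    unfolding prox_def obj_def[abs_def] arg_min_def by (rule someI)
  then show ?thesis by (auto simp: is_arg_min_def not_less)
qed

lemma g_prox_finite:
  obtains c where "g (prox \<mu> g v) = ereal c"
proof -
  obtain u0 a where u0: "g u0 = ereal a" by (rule finite_point)
  show ?thesis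
    using prox_minimizer[of v u0] not_MInfty[of "prox \<mu> g v"] u0 that
    by (cases "g (prox \<mu> g v)") (auto simp: obj_def)
qed

text \<open>The minimizer is compared with points on the segment towards \<open>u\<close>. Convexity
  bounds the change of \<open>g\<close> linearly in \<open>t\<close>; dividing the resulting
  inequality by \<open>t\<close> and letting \<open>t\<close> tend to 0 from the right leaves the
  first-order condition.\<close>

lemma prox_variational:
  assumes u: "g u = ereal b" and p: "g (prox \<mu> g v) = ereal c"
  shows "c + 1 / \<mu> * ((v - prox \<mu> g v) \<bullet> (u - prox \<mu> g v)) \<le> b"
proof -
  let ?p = "prox \<mu> g v"
  \<comment> \<open>\<open>e\<close> is the slack in the claimed inequality. The product
    \<open>t * (e + t * n)\<close> is the upper bound that convexity yields for
    \<open>obj v w - obj v ?p\<close>.\<close>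
  define e where "e = b - c - 1 / \<mu> * ((v - ?p) \<bullet> (u - ?p))"
  define n where "n = 1 / (2 * \<mu>) * (norm (u - ?p))\<^sup>2"
  have ineq: "0 \<le> e + t * n" if t: "0 < t" "t \<le> 1" for t
  proof -
    define w where "w = (1 - t) *\<^sub>R ?p + t *\<^sub>R u"
    have "g w \<le> ereal ((1 - t) * c + t * b)"
      unfolding w_def using t by (intro convex_real p u) auto
    moreover have "obj v ?p \<le> obj v w" by (rule prox_minimizer)
    ultimately have 1: "c + 1 / (2 * \<mu>) * (norm (?p - v))\<^sup>2
        \<le> (1 - t) * c + t * b + 1 / (2 * \<mu>) * (norm (w - v))\<^sup>2"
      unfolding obj_def p by (cases "g w") auto
    have "w - v = (?p - v) + t *\<^sub>R (u - ?p)" by (simp add: w_def algebra_simps)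
    then have 2: "(norm (w - v))\<^sup>2
        = (norm (?p - v))\<^sup>2 - 2 * t * ((v - ?p) \<bullet> (u - ?p)) + t\<^sup>2 * (norm (u - ?p))\<^sup>2"
      by (simp only: power2_norm_eq_inner)
        (simp add: inner_simps inner_commute power2_eq_square algebra_simps)
    have "t * (e + t * n) = ((1 - t) * c + t * b + 1 / (2 * \<mu>) * (norm (w - v))\<^sup>2)
       - (c + 1 / (2 * \<mu>) * (norm (?p - v))\<^sup>2)"
      unfolding 2 e_def n_def using \<mu> by (simp add: field_simps power2_eq_square)
    with 1 have "0 \<le> t * (e + t * n)" by linarith
    then show ?thesis using t by (simp add: zero_le_mult_iff)
  qed
  have "((\<lambda>t. e + t * n) \<longlongrightarrow> e + 0 * n) (at_right 0)"
    by (intro tendsto_intros)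
  moreover have "\<forall>\<^sub>F t in at_right 0. 0 \<le> e + t * n"
    by (rule eventually_at_rightI[of 0 1]) (auto intro: ineq)
  ultimately have "0 \<le> e"
    using tendsto_lowerbound by fastforce
  then show ?thesis by (simp add: e_def)
qed

text \<open>Expanding the square around the proximal point and using the variational inequality
  shows that \<open>obj v u\<close> exceeds the minimum by at least
  \<open>1 / (2 * \<mu>) * (norm (u - ?p))\<^sup>2\<close>.\<close>

lemma prox_unique:
  assumes "obj v u \<le> obj v (prox \<mu> g v)"
  shows "u = prox \<mu> g v"
proof -
  let ?p = "prox \<mu> g v"
  obtain c where c: "g ?p = ereal c" by (rule g_prox_finite)
  with assms not_MInfty[of u] obtain b where b: "g u = ereal b"
    by (cases "g u") (auto simp: obj_def)
  have 1: "b + 1 / (2 * \<mu>) * (norm (u - v))\<^sup>2 \<le> c + 1 / (2 * \<mu>) * (norm (?p - v))\<^sup>2"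
    using assms b c by (simp add: obj_def)
  have "(norm (u - v))\<^sup>2 = (norm (u - ?p))\<^sup>2 - 2 * ((v - ?p) \<bullet> (u - ?p)) + (norm (?p - v))\<^sup>2"
    by (simp add: power2_norm_eq_inner inner_simps inner_commute)
  then have "1 / (2 * \<mu>) * (norm (u - v))\<^sup>2 = 1 / (2 * \<mu>) * (norm (u - ?p))\<^sup>2
      - 1 / \<mu> * ((v - ?p) \<bullet> (u - ?p)) + 1 / (2 * \<mu>) * (norm (?p - v))\<^sup>2"
    using \<mu> by (simp add: field_simps)
  with 1 prox_variational[OF b c] have "1 / (2 * \<mu>) * (norm (u - ?p))\<^sup>2 \<le> 0"
    by linarith
  then have "(norm (u - ?p))\<^sup>2 \<le> 0" using \<mu> by (simp add: field_simps)
  then show ?thesis by simp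
qed

lemma prox_firmly_nonexpansive:
  "(norm (prox \<mu> g v - prox \<mu> g w))\<^sup>2 \<le> (v - w) \<bullet> (prox \<mu> g v - prox \<mu> g w)"
proof -
  let ?p = "prox \<mu> g v" and ?q = "prox \<mu> g w"
  obtain c where c: "g ?p = ereal c" by (rule g_prox_finite)
  obtain d where d: "g ?q = ereal d" by (rule g_prox_finite)
  have "1 / \<mu> * ((v - ?p) \<bullet> (?q - ?p) + (w - ?q) \<bullet> (?p - ?q)) \<le> 0"
    using prox_variational[OF d c] prox_variational[OF c d] by (simp add: distrib_left)
  then have "(v - ?p) \<bullet> (?q - ?p) + (w - ?q) \<bullet> (?p - ?q) \<le> 0"
    using \<mu> by (simp add: field_simps)
  then show ?thesis
    by (simp add: power2_norm_eq_inner inner_simps inner_commute)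
qed

text \<open>Firm nonexpansiveness makes the cross term in the expanded square outweigh
  \<open>(norm a)\<^sup>2\<close>. The residual divided by \<mu> will be the gradient of the
  envelope, so this bound serves both its differentiability and its Lipschitz estimate.\<close>

lemma norm_prox_residual_diff_le: "norm ((v - prox \<mu> g v) - (w - prox \<mu> g w)) \<le> norm (v - w)"
proof (rule power2_le_imp_le)
  define a where "a = prox \<mu> g v - prox \<mu> g w"
  have "(norm a)\<^sup>2 \<le> (v - w) \<bullet> a" "0 \<le> (norm a)\<^sup>2"
    unfolding a_def using prox_firmly_nonexpansive by auto
  moreover have "(norm ((v - w) - a))\<^sup>2 = (norm (v - w))\<^sup>2 - 2 * ((v - w) \<bullet> a) + (norm a)\<^sup>2"
    by (simp add: power2_norm_eq_inner inner_diff_left inner_diff_right inner_commute)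
  ultimately have "(norm ((v - w) - a))\<^sup>2 \<le> (norm (v - w))\<^sup>2" by linarith
  then show "(norm ((v - prox \<mu> g v) - (w - prox \<mu> g w)))\<^sup>2 \<le> (norm (v - w))\<^sup>2"
    by (simp add: a_def algebra_simps)
qed simp

section \<open>The Moreau envelope and its gradient\<close>

lemma moreau_envelope_eq: "moreau_envelope \<mu> g v = obj v (prox \<mu> g v)"
  by (simp add: moreau_envelope_def obj_def)

definition M :: "'a \<Rightarrow> real" where
  "M v = real_of_ereal (moreau_envelope \<mu> g v)"

lemma ereal_M: "moreau_envelope \<mu> g v = ereal (M v)"
  by (rule g_prox_finite[of v]) (simp add: M_def moreau_envelope_def)

text \<open>The proximal point of \<open>v\<close> is a competitor in the problem defining
  \<open>M w\<close>. The value of \<open>g\<close> there cancels, and expanding the difference of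
  the two quadratics gives exactly the linear term and the error on the right.\<close>

lemma M_upper:
  "M w - M v - (w - v) \<bullet> ((v - prox \<mu> g v) /\<^sub>R \<mu>) \<le> 1 / (2 * \<mu>) * (norm (w - v))\<^sup>2"
proof -
  let ?p = "prox \<mu> g v"
  obtain c where c: "g ?p = ereal c" by (rule g_prox_finite)
  have "ereal (M w) \<le> obj w ?p"
    unfolding ereal_M[symmetric] moreau_envelope_eq by (rule prox_minimizer)
  then have 1: "M w \<le> c + 1 / (2 * \<mu>) * (norm (?p - w))\<^sup>2" by (simp add: obj_def c)
  have "ereal (M v) = obj v ?p"
    unfolding ereal_M[symmetric] moreau_envelope_eq ..
  then have 2: "M v = c + 1 / (2 * \<mu>) * (norm (?p - v))\<^sup>2" by (simp add: obj_def c)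
  have "?p - w = (?p - v) - (w - v)" by simp
  then have 3: "(norm (?p - w))\<^sup>2 = (norm (?p - v))\<^sup>2 + 2 * ((w - v) \<bullet> (v - ?p)) + (norm (w - v))\<^sup>2"
    by (simp only: power2_norm_eq_inner) (simp add: inner_simps inner_commute)
  have "1 / (2 * \<mu>) * (norm (?p - w))\<^sup>2 = 1 / (2 * \<mu>) * (norm (?p - v))\<^sup>2
      + (w - v) \<bullet> ((v - ?p) /\<^sub>R \<mu>) + 1 / (2 * \<mu>) * (norm (w - v))\<^sup>2"
    unfolding 3 inner_scaleR_right using \<mu> by (simp add: field_simps)
  with 1 2 show ?thesis by linarith
qed

text \<open>The lower estimate is \<open>M_upper\<close> with \<open>v\<close> and \<open>w\<close>
  exchanged, which involves the residual at \<open>w\<close>. Replacing it by the residual at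
  \<open>v\<close> costs at most \<open>1 / \<mu> * (norm (w - v))\<^sup>2\<close>, by
  Cauchy-Schwarz and nonexpansiveness. Together this is 3/2 of that quantity, and the constant
  \<open>2 / \<mu>\<close> covers both sides.\<close>

lemma M_remainder:
  "\<bar>M w - M v - (w - v) \<bullet> ((v - prox \<mu> g v) /\<^sub>R \<mu>)\<bar> \<le> 2 / \<mu> * (norm (w - v))\<^sup>2"
proof -
  let ?r = "\<lambda>v. v - prox \<mu> g v"
  have "(w - v) \<bullet> (?r v - ?r w) \<le> norm (w - v) * norm (?r v - ?r w)"
    by (rule norm_cauchy_schwarz)
  also have "\<dots> \<le> norm (w - v) * norm (w - v)"
    using norm_prox_residual_diff_le[of v w] by (intro mult_left_mono) (auto simp: norm_minus_commute)
  finally have "1 / \<mu> * ((w - v) \<bullet> (?r v - ?r w)) \<le> 1 / \<mu> * (norm (w - v))\<^sup>2"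
    using \<mu> by (intro mult_left_mono) (auto simp: power2_eq_square)
  moreover have "1 / \<mu> * ((w - v) \<bullet> (?r v - ?r w))
      = (w - v) \<bullet> (?r v /\<^sub>R \<mu>) + (v - w) \<bullet> (?r w /\<^sub>R \<mu>)"
    by (simp add: inner_diff_left inner_diff_right inner_commute diff_divide_distrib divide_inverse
        algebra_simps)
  moreover have "2 / \<mu> * (norm (w - v))\<^sup>2 = 1 / (2 * \<mu>) * (norm (w - v))\<^sup>2 + 3 / 2 * (1 / \<mu> * (norm (w - v))\<^sup>2)"
    using \<mu> by (simp add: field_simps)
  moreover have "0 \<le> 1 / \<mu> * (norm (w - v))\<^sup>2" using \<mu> by simp
  ultimately show ?thesis
    using M_upper[of w v] M_upper[of v w]
    unfolding norm_minus_commute[of v w] by linarith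
qed

lemma GDERIV_M: "GDERIV M v :> (v - prox \<mu> g v) /\<^sub>R \<mu>"
  unfolding gderiv_def has_derivative_at_within
proof (intro conjI bounded_linear_inner_left)
  let ?G = "(v - prox \<mu> g v) /\<^sub>R \<mu>"
  have "((\<lambda>w. 2 / \<mu> * norm (w - v)) \<longlongrightarrow> 2 / \<mu> * norm (v - v)) (at v)"
    by (intro tendsto_intros)
  then have lim: "((\<lambda>w. 2 / \<mu> * norm (w - v)) \<longlongrightarrow> 0) (at v)" by simp
  show "((\<lambda>w. (M w - M v - (w - v) \<bullet> ?G) /\<^sub>R norm (w - v)) \<longlongrightarrow> 0) (at v)"
  proof (rule Lim_null_comparison[OF always_eventually[OF allI] lim])
    fix w
    show "norm ((M w - M v - (w - v) \<bullet> ?G) /\<^sub>R norm (w - v)) \<le> 2 / \<mu> * norm (w - v)"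
    proof (cases "w = v")
      case False
      then show ?thesis using M_remainder[of w v]
        by (simp add: field_simps power2_eq_square)
    qed simp
  qed
qed

text \<open>This is the proximal augmented Lagrangian without \<open>f\<close>. Its gradient is
  globally Lipschitz in \<open>(x, y)\<close> jointly, so the smoothness of the whole is inherited
  from \<open>f\<close>.\<close>

lemma GDERIV_M_penalized:
  fixes T :: "'c::euclidean_space \<Rightarrow> 'a"
  assumes T: "linear T"
  shows "\<exists>H L. L-lipschitz_on UNIV H \<and>
    (\<forall>z. GDERIV (\<lambda>(x, y). M (T x + \<mu> *\<^sub>R y) - \<mu> / 2 * (norm y)\<^sup>2) z :> H z)"
proof -
  define A where "A = (\<lambda>z. T (fst z) + \<mu> *\<^sub>R snd z)"
  define R where "R = (\<lambda>z. (A z - prox \<mu> g (A z)) /\<^sub>R \<mu>)"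
  \<comment> \<open>By the chain rule through the linear map \<open>A\<close>, the adjoint of
    \<open>T\<close> carries the envelope gradient \<open>R z\<close> to the \<open>x\<close>
    component. In the \<open>y\<close> component it is scaled by \<mu>, and the penalty subtracts
    \<open>\<mu> *\<^sub>R snd z\<close>.\<close>
  define H where "H = (\<lambda>z. (adjoint T (R z), \<mu> *\<^sub>R (R z - snd z)))"
  have lin_A: "linear A"
    unfolding A_def using T by (auto simp: linear_iff algebra_simps)
  have "GDERIV (\<lambda>(x, y). M (T x + \<mu> *\<^sub>R y) - \<mu> / 2 * (norm y)\<^sup>2) z :> H z" for z
  proof -
    have "(A has_derivative A) (at z)"
      using lin_A by (simp add: linear_imp_has_derivative)
    then have "((\<lambda>z. M (A z)) has_derivative (\<lambda>h. A h \<bullet> R z)) (at z)"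
      unfolding R_def using has_derivative_compose GDERIV_M[unfolded gderiv_def] by blast
    moreover have "((\<lambda>z. \<mu> / 2 * (snd z \<bullet> snd z)) has_derivative (\<lambda>h. snd h \<bullet> (\<mu> *\<^sub>R snd z))) (at z)"
      by (auto intro!: derivative_eq_intros simp: inner_commute)
    ultimately have "((\<lambda>z. M (A z) - \<mu> / 2 * (snd z \<bullet> snd z))
        has_derivative (\<lambda>h. A h \<bullet> R z - snd h \<bullet> (\<mu> *\<^sub>R snd z))) (at z)"
      by (rule has_derivative_diff)
    moreover have "A h \<bullet> R z - snd h \<bullet> (\<mu> *\<^sub>R snd z) = h \<bullet> H z" for h
      by (cases h) (simp add: A_def H_def inner_add_left inner_diff_right adjoint_works[OF T] algebra_simps)
    ultimately show ?thesis
      by (simp add: gderiv_def A_def case_prod_unfold power2_norm_eq_inner)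
  qed
  moreover have "\<exists>L. L-lipschitz_on UNIV H"
  proof -
    obtain K where K: "K-lipschitz_on UNIV A"
      using lin_A by (metis bounded_linear.lipschitz_boundE linear_conv_bounded_linear)
    obtain K' where K': "K'-lipschitz_on UNIV (adjoint T)"
      using adjoint_linear[OF T] by (metis bounded_linear.lipschitz_boundE linear_conv_bounded_linear)
    have res: "1-lipschitz_on UNIV (\<lambda>v. v - prox \<mu> g v)"
      using norm_prox_residual_diff_le by (intro lipschitz_onI) (auto simp: dist_norm)
    have snd_lip: "1-lipschitz_on UNIV (snd :: 'c \<times> 'a \<Rightarrow> 'a)"
      by (intro lipschitz_onI) (auto simp: dist_snd_le)
    note R = lipschitz_on_cmult[OF lipschitz_on_compose2[OF K lipschitz_on_subset[OF res subset_UNIV]],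
        of "inverse \<mu>", folded R_def]
    show ?thesis
      unfolding H_def
      using lipschitz_on_Pair[OF lipschitz_on_compose2[OF R lipschitz_on_subset[OF K' subset_UNIV]]
          lipschitz_on_cmult[OF lipschitz_on_diff[OF R snd_lip]]]
      by blast
  qed
  ultimately show ?thesis by blast
qed

section \<open>Eliminating \<open>z\<close> from the augmented Lagrangian\<close>

lemma aug_lagrangian_eq_obj:
  "aug_lagrangian f g T \<mu> x z y = ereal (f x - \<mu> / 2 * (norm y)\<^sup>2) + obj (T x + \<mu> *\<^sub>R y) z"
proof -
  have "z - (T x + \<mu> *\<^sub>R y) = - ((T x - z) + \<mu> *\<^sub>R y)"
    by simp
  then have "(norm (z - (T x + \<mu> *\<^sub>R y)))\<^sup>2 = (norm ((T x - z) + \<mu> *\<^sub>R y))\<^sup>2"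
    by (simp only: norm_minus_cancel)
  also have "\<dots> = (norm (T x - z))\<^sup>2 + 2 * \<mu> * (y \<bullet> (T x - z)) + \<mu>\<^sup>2 * (norm y)\<^sup>2"
    by (simp only: power2_norm_eq_inner)
      (simp add: inner_add_left inner_add_right inner_commute power2_eq_square algebra_simps)
  finally have "1 / (2 * \<mu>) * (norm (z - (T x + \<mu> *\<^sub>R y)))\<^sup>2 - \<mu> / 2 * (norm y)\<^sup>2
      = y \<bullet> (T x - z) + 1 / (2 * \<mu>) * (norm (T x - z))\<^sup>2"
    using \<mu> by (simp add: field_simps power2_eq_square)
  then show ?thesis
    using not_MInfty[of z]
    by (cases "g z") (auto simp: aug_lagrangian_def obj_def)
qed

lemma prox_aug_lagrangian_real:
  "prox_aug_lagrangian f g T \<mu> x y = ereal (f x + (M (T x + \<mu> *\<^sub>R y) - \<mu> / 2 * (norm y)\<^sup>2))"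
  by (simp add: prox_aug_lagrangian_def ereal_M)

lemma aug_lagrangian_prox:
  "aug_lagrangian f g T \<mu> x (prox \<mu> g (T x + \<mu> *\<^sub>R y)) y = prox_aug_lagrangian f g T \<mu> x y"
  by (simp add: aug_lagrangian_eq_obj prox_aug_lagrangian_real
      moreau_envelope_eq[symmetric] ereal_M)

lemma prox_aug_lagrangian_le: "prox_aug_lagrangian f g T \<mu> x y \<le> aug_lagrangian f g T \<mu> x z y"
  unfolding aug_lagrangian_prox[symmetric] aug_lagrangian_eq_obj
  by (intro add_left_mono prox_minimizer)

lemma aug_lagrangian_le_prox_iff:
  "aug_lagrangian f g T \<mu> x z y \<le> prox_aug_lagrangian f g T \<mu> x y \<longleftrightarrow> z = prox \<mu> g (T x + \<mu> *\<^sub>R y)"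
proof
  assume "aug_lagrangian f g T \<mu> x z y \<le> prox_aug_lagrangian f g T \<mu> x y"
  then have "obj (T x + \<mu> *\<^sub>R y) z \<le> obj (T x + \<mu> *\<^sub>R y) (prox \<mu> g (T x + \<mu> *\<^sub>R y))"
    unfolding aug_lagrangian_prox[symmetric] aug_lagrangian_eq_obj
    by (simp add: ereal_add_le_add_iff)
  then show "z = prox \<mu> g (T x + \<mu> *\<^sub>R y)" by (rule prox_unique)
qed (simp add: aug_lagrangian_prox)

lemma equivalent_minimization: "equivalent_minimization f g T \<mu> y"
proof -
  let ?L = "\<lambda>x z. aug_lagrangian f g T \<mu> x z y" and ?P = "\<lambda>x. prox_aug_lagrangian f g T \<mu> x y"
  let ?p = "\<lambda>x. prox \<mu> g (T x + \<mu> *\<^sub>R y)"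
  \<comment> \<open>This expresses that \<open>?P x\<close> is the attained minimum of
    \<open>?L x\<close> over \<open>z\<close>. It reduces each statement about minimizers to
    inequalities against \<open>?P\<close>, with no assumption that a minimizer in \<open>x\<close>
    exists.\<close>
  have lower_bound_iff: "(\<forall>z'. c \<le> ?L x z') \<longleftrightarrow> c \<le> ?P x" for c x
  proof
    assume "\<forall>z'. c \<le> ?L x z'"
    then have "c \<le> ?L x (?p x)" ..
    then show "c \<le> ?P x" by (simp only: aug_lagrangian_prox)
  next
    assume "c \<le> ?P x"
    then show "\<forall>z'. c \<le> ?L x z'"
      by (intro allI order_trans[OF _ prox_aug_lagrangian_le])
  qed
  have min_z: "is_arg_min (?L x) (\<lambda>_. True) z \<longleftrightarrow> z = ?p x" for x z
  proof -
    have "(\<forall>z'. ?L x z \<le> ?L x z') \<longleftrightarrow> ?L x z \<le> ?P x"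
      by (rule lower_bound_iff)
    then show ?thesis
      by (simp add: is_arg_min_linorder aug_lagrangian_le_prox_iff)
  qed
  have "(INF (x, z) \<in> UNIV. ?L x z) = (INF x. ?P x)"
  proof (rule antisym)
    show "(INF (x, z) \<in> UNIV. ?L x z) \<le> (INF x. ?P x)"
    proof (rule INF_greatest)
      fix x
      show "(INF (x, z) \<in> UNIV. ?L x z) \<le> ?P x"
        by (rule INF_lower2[of "(x, ?p x)"]) (simp_all add: aug_lagrangian_prox)
    qed
    show "(INF x. ?P x) \<le> (INF (x, z) \<in> UNIV. ?L x z)"
    proof (rule INF_greatest, clarify)
      fix x z
      show "(INF x. ?P x) \<le> ?L x z"
        by (rule INF_lower2[of x]) (simp_all add: prox_aug_lagrangian_le)
    qed
  qed
  moreover have "is_arg_min (\<lambda>(x', z'). ?L x' z') (\<lambda>_. True) (x, z)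
      \<longleftrightarrow> is_arg_min ?P (\<lambda>_. True) x \<and> z = ?p x" for x z
  proof -
    have "(\<forall>x' z'. ?L x z \<le> ?L x' z') \<longleftrightarrow> (\<forall>x'. ?L x z \<le> ?P x')"
      by (simp only: lower_bound_iff)
    also have "\<dots> \<longleftrightarrow> (\<forall>x'. ?P x \<le> ?P x') \<and> z = ?p x"
    proof
      \<comment> \<open>The instance at \<open>x\<close> itself forces \<open>z\<close> to be the
        proximal point; then \<open>?L x z\<close> equals \<open>?P x\<close> and the other
        instances say that \<open>x\<close> is minimal.\<close>
      assume le: "\<forall>x'. ?L x z \<le> ?P x'"
      then have "?L x z \<le> ?P x" ..
      then have "z = ?p x" by (simp only: aug_lagrangian_le_prox_iff)
      with le show "(\<forall>x'. ?P x \<le> ?P x') \<and> z = ?p x"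
        by (simp add: aug_lagrangian_prox)
    qed (simp add: aug_lagrangian_prox)
    finally show ?thesis by (simp add: is_arg_min_linorder)
  qed
  ultimately show ?thesis
    unfolding equivalent_minimization_def by (intro conjI allI min_z aug_lagrangian_prox)
qed

end

section \<open>Smoothness of the proximal augmented Lagrangian in \<open>(x, y)\<close>\<close>

lemma GDERIV_fst:
  assumes "GDERIV f (fst z) :> D"
  shows "GDERIV (\<lambda>z. f (fst z)) z :> (D, 0)"
  using has_derivative_compose[OF has_derivative_fst[OF has_derivative_ident] assms[unfolded gderiv_def]]
  by (simp add: gderiv_def inner_prod_def)

theorem theorem1:
  fixes f :: "'a::euclidean_space \<Rightarrow> real"
    and g :: "'b::euclidean_space \<Rightarrow> ereal"
    and T :: "'a \<Rightarrow> 'b"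
    and \<mu> :: real
  assumes "bounded_linear T"
    and "\<mu> > 0"
    and "proper_fun g"
    and "lower_semicontinuous g"
    and "convex_fun g"
  shows "(\<forall>y. equivalent_minimization f g T \<mu> y) \<and>
    (\<forall>x y. \<bar>prox_aug_lagrangian f g T \<mu> x y\<bar> \<noteq> \<infinity>) \<and>
    (continuously_differentiable f \<longrightarrow>
       continuously_differentiable (\<lambda>(x, y). real_of_ereal (prox_aug_lagrangian f g T \<mu> x y))) \<and>
    (lipschitz_gradient f \<longrightarrow>
       lipschitz_gradient (\<lambda>(x, y). real_of_ereal (prox_aug_lagrangian f g T \<mu> x y)))"
proof -
  interpret moreau g \<mu>
    using assms by unfold_locales
  let ?P = "\<lambda>(x, y). real_of_ereal (prox_aug_lagrangian f g T \<mu> x y)"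
  obtain H L where H: "L-lipschitz_on UNIV H"
    and deriv_H: "\<And>z. GDERIV (\<lambda>(x, y). M (T x + \<mu> *\<^sub>R y) - \<mu> / 2 * (norm y)\<^sup>2) z :> H z"
    using GDERIV_M_penalized[OF bounded_linear.linear[OF assms(1)]] by blast
  have P: "?P = (\<lambda>z. f (fst z) + (\<lambda>(x, y). M (T x + \<mu> *\<^sub>R y) - \<mu> / 2 * (norm y)\<^sup>2) z)"
    by (simp add: prox_aug_lagrangian_real fun_eq_iff)
  \<comment> \<open>Stated for an arbitrary gradient \<open>G\<close> of \<open>f\<close>, this
    formula serves both smoothness claims: continuity or a Lipschitz bound passes from
    \<open>G\<close> to the sum with the Lipschitz map \<open>H\<close>.\<close>
  have deriv_P: "GDERIV ?P z :> (G (fst z), 0) + H z" if "\<And>x. GDERIV f x :> G x" for G z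
    unfolding P by (intro GDERIV_add GDERIV_fst that deriv_H)
  have C1: "continuously_differentiable ?P" if "continuously_differentiable f"
  proof -
    from that obtain G where G: "\<And>x. GDERIV f x :> G x" "continuous_on UNIV G"
      by (auto simp: continuously_differentiable_def)
    have "continuous_on UNIV (\<lambda>z. (G (fst z), 0) + H z)"
      by (intro continuous_intros continuous_on_compose2[OF G(2)] lipschitz_on_continuous_on[OF H]) auto
    then show ?thesis
      unfolding continuously_differentiable_def using deriv_P[OF G(1)] by (intro exI conjI allI)
  qed
  have lip: "lipschitz_gradient ?P" if "lipschitz_gradient f"
  proof -
    from that obtain G K where G: "\<And>x. GDERIV f x :> G x" "K-lipschitz_on UNIV G"
      by (auto simp: lipschitz_gradient_def)
    have fst_lip: "1-lipschitz_on UNIV (fst :: 'a \<times> 'b \<Rightarrow> 'a)"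
      by (intro lipschitz_onI) (auto simp: dist_fst_le)
    note grad = lipschitz_on_add[OF lipschitz_on_Pair[OF lipschitz_on_compose2[OF fst_lip
          lipschitz_on_subset[OF G(2) subset_UNIV]] lipschitz_on_constant] H]
    show ?thesis
      unfolding lipschitz_gradient_def using deriv_P[OF G(1)] grad by (intro exI conjI allI)
  qed
  have fin: "\<bar>prox_aug_lagrangian f g T \<mu> x y\<bar> \<noteq> \<infinity>" for x y
    by (simp add: prox_aug_lagrangian_real)
  show ?thesis
    by (intro conjI allI impI equivalent_minimization fin C1 lip)
qed

end
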